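(* Let $(\mathbf{X},\mathbf{T})$ be a nonautonomous dynamical system, let $E\subset X_0$ be a Borel set, let $s>0$, and let $\mu$ be a Borel probability measure on $X_0$. (1) If $\underline{h}_{\mu}(\mathbf{T},x)\le s$ for all $x\in E$, then $h_{\mathrm{top}}^{\mathrm{B}}(\mathbf{T},E)\le s$. (2) If $\underline{h}_{\mu}(\mathbf{T},x)\ge s$ for all $x\in E$ and $\mu(E)>0$, then $h_{\mathrm{top}}^{\mathrm{B}}(\mathbf{T},E)\ge s$.
   Context: A nonautonomous dynamical system (NDS) $(\mathbf{X},\mathbf{T})$ consists of a sequence $\mathbf{X}=\{X_k\}_{k=0}^\infty$ of compact metric spaces $(X_k,d_k)$ and a sequence $\mathbf{T}=\{T_k\}_{k=0}^\infty$ of continuous maps $T_k:X_k\to X_{k+1}$. Put $\mathbf{T}^0=\mathrm{id}_{X_0}$ and $\mathbf{T}^j=T_{j-1}\circ\cdots\circ T_0:X_0\to X_j$. For $n\ge1$ and $x,y\in X_0$ let $d_n^{\mathbf{T}}(x,y)=\max_{0\le j\le n-1}d_j(\mathbf{T}^jx,\mathbf{T}^jy)$, and for $\varepsilon>0$ let $B_n^{\mathbf{T}}(x,\varepsilon)=\{y\in X_0:d_n^{\mathbf{T}}(x,y)<\varepsilon\}$ (Bowen ball). Measure-theoretic lower local entropy: $\underline{h}_\mu(\mathbf{T},x)=\lim_{\varepsilon\to0}\liminf_{n\to\infty}\frac{-\log\mu(B_n^{\mathbf{T}}(x,\varepsilon))}{n}$, with $\log0=-\infty$. Bowen entropy: for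 $Z\subset X_0$, an $(N,\varepsilon)$-cover of $Z$ is a family $\{B_{n_i}^{\mathbf{T}}(x_i,\varepsilon)\}_i$ with $x_i\in X_0$ and integers $n_i\ge N$ whose union contains $Z$. For $s\in\mathbb{R}$, $N,\varepsilon>0$ let $\mathscr{R}_{N,\varepsilon}^{s}(\mathbf{T},\mathbf{0},Z)=\inf\sum_i\exp(-n_is)$ over all countable (finite or infinite) $(N,\varepsilon)$-covers of $Z$; $\mathscr{R}_{\varepsilon}^{s}(\mathbf{T},\mathbf{0},Z)=\lim_{N\to\infty}\mathscr{R}_{N,\varepsilon}^{s}(\mathbf{T},\mathbf{0},Z)$; $h_{\mathrm{top}}^{\mathrm{B}}(\mathbf{T},Z)=\lim_{\varepsilon\to0}\inf\{s:\mathscr{R}_{\varepsilon}^{s}(\mathbf{T},\mathbf{0},Z)=0\}$ (monotone limit). *)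

theory Defs
  imports "HOL-Analysis.Analysis" "HOL-Probability.Probability"
begin

(* The spaces X k are arbitrary carrier-based metric spaces with separate metrics.
   Sharing the element type 'a is no restriction: a sequence of
   spaces can be embedded in a common disjoint union. *)
definition nds :: "(nat \<Rightarrow> 'a metric) \<Rightarrow> (nat \<Rightarrow> 'a \<Rightarrow> 'a) \<Rightarrow> bool" where
  "nds X T \<longleftrightarrow>
     (\<forall>k. compact_space (mtopology_of (X k))) \<and>
     (\<forall>k. continuous_map (mtopology_of (X k)) (mtopology_of (X (Suc k))) (T k))"

primrec nds_iter :: "(nat \<Rightarrow> 'a \<Rightarrow> 'a) \<Rightarrow> nat \<Rightarrow> 'a \<Rightarrow> 'a" where
  "nds_iter T 0 = id"
| "nds_iter T (Suc j) = T j \<circ> nds_iter T j"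

(* Meaningful for n \<ge> 1 only; every use below is a limit in which n tends to infinity. *)
definition bowen_dist ::
  "(nat \<Rightarrow> 'a metric) \<Rightarrow> (nat \<Rightarrow> 'a \<Rightarrow> 'a) \<Rightarrow> nat \<Rightarrow> 'a \<Rightarrow> 'a \<Rightarrow> real" where
  "bowen_dist X T n x y =
     Max ((\<lambda>j. mdist (X j) (nds_iter T j x) (nds_iter T j y)) ` {0..n - 1})"

definition bowen_ball ::
  "(nat \<Rightarrow> 'a metric) \<Rightarrow> (nat \<Rightarrow> 'a \<Rightarrow> 'a) \<Rightarrow> nat \<Rightarrow> 'a \<Rightarrow> real \<Rightarrow> 'a set" where
  "bowen_ball X T n x \<epsilon> = {y \<in> mspace (X 0). bowen_dist X T n x y < \<epsilon>}"

definition borel_of_metric :: "'a metric \<Rightarrow> 'a measure" where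
  "borel_of_metric m = sigma (mspace m) {U. openin (mtopology_of m) U}"

(* The HOL function ln has ln 0 = 0, whereas here log 0 = -\<infinity>. *)
definition neg_log :: "real \<Rightarrow> ereal" where
  "neg_log p = (if p = 0 then \<infinity> else ereal (- ln p))"

(* The limit always exists, as the lower limit is nonincreasing in \<epsilon>. *)
definition lower_local_entropy ::
  "(nat \<Rightarrow> 'a metric) \<Rightarrow> (nat \<Rightarrow> 'a \<Rightarrow> 'a) \<Rightarrow> 'a measure \<Rightarrow> 'a \<Rightarrow> ereal" where
  "lower_local_entropy X T \<mu> x =
     Lim (at_right (0::real))
       (\<lambda>\<epsilon>. liminf (\<lambda>n. neg_log (measure \<mu> (bowen_ball X T n x \<epsilon>)) / ereal (real n)))"

(* A countable family of Bowen balls, finite or infinite and possibly with repetitions,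
   is indexed by an arbitrary set I of natural numbers. *)
definition bowen_cover ::
  "(nat \<Rightarrow> 'a metric) \<Rightarrow> (nat \<Rightarrow> 'a \<Rightarrow> 'a) \<Rightarrow> nat \<Rightarrow> real \<Rightarrow> 'a set \<Rightarrow>
    nat set \<Rightarrow> (nat \<Rightarrow> nat) \<Rightarrow> (nat \<Rightarrow> 'a) \<Rightarrow> bool" where
  "bowen_cover X T N \<epsilon> Z I n x \<longleftrightarrow>
     (\<forall>i\<in>I. x i \<in> mspace (X 0) \<and> N \<le> n i) \<and>
     Z \<subseteq> (\<Union>i\<in>I. bowen_ball X T (n i) (x i) \<epsilon>)"

definition bowen_sum_N ::
  "(nat \<Rightarrow> 'a metric) \<Rightarrow> (nat \<Rightarrow> 'a \<Rightarrow> 'a) \<Rightarrow> real \<Rightarrow> nat \<Rightarrow> real \<Rightarrow> 'a set \<Rightarrow> ennreal" where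
  "bowen_sum_N X T s N \<epsilon> Z =
     Inf {(\<Sum>\<^sub>\<infinity>i\<in>I. ennreal (exp (- real (n i) * s))) |I n x. bowen_cover X T N \<epsilon> Z I n x}"

(* The limit always exists, as bowen_sum_N is nondecreasing in N. *)
definition bowen_sum ::
  "(nat \<Rightarrow> 'a metric) \<Rightarrow> (nat \<Rightarrow> 'a \<Rightarrow> 'a) \<Rightarrow> real \<Rightarrow> real \<Rightarrow> 'a set \<Rightarrow> ennreal" where
  "bowen_sum X T s \<epsilon> Z = lim (\<lambda>N. bowen_sum_N X T s N \<epsilon> Z)"

(* The infimum of the empty set is \<infinity>. The limit always exists, as the infimum is
   nonincreasing in \<epsilon>. *)
definition bowen_entropy ::
  "(nat \<Rightarrow> 'a metric) \<Rightarrow> (nat \<Rightarrow> 'a \<Rightarrow> 'a) \<Rightarrow> 'a set \<Rightarrow> ereal" where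
  "bowen_entropy X T Z =
     Lim (at_right (0::real)) (\<lambda>\<epsilon>. Inf {ereal s |s. bowen_sum X T s \<epsilon> Z = 0})"

end

theory Submission
  imports Defs
begin

text \<open>
  Both limits over \<open>\<epsilon>\<close> are suprema by monotonicity. For (1), every \<open>x \<in> E\<close> has arbitrarily large
  times \<open>n\<close> with \<open>\<mu>(B\<^sub>n(x, \<epsilon>)) > exp (- n t)\<close>, for any \<open>t > s\<close>. Selecting such balls
  greedily in the order of increasing \<open>n\<close> yields a disjoint family whose enlargements to radius
  \<open>2\<epsilon>\<close> cover \<open>E\<close>, and disjointness bounds the sum of the weights \<open>exp (- n t)\<close> by 1.
  For (2), the set of points of \<open>E\<close> at which \<open>\<mu>(B\<^sub>n(x, \<epsilon>)) \<le> exp (- n t)\<close> for all \<open>n \<ge> k\<close>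
  is bounded in outer measure by the weight of any cover by balls of radius \<open>\<epsilon>/2\<close>, so if these
  weights could be made arbitrarily small for every \<open>\<epsilon>\<close>, then \<open>E\<close> would be a countable union
  of null sets.
\<close>

section \<open>Monotone limits, disjoint selection and finite measures\<close>

lemma Lim_at_right_0_antimono:
  fixes f :: "real \<Rightarrow> 'b :: {complete_linorder, linorder_topology}"
  assumes "antimono_on {0<..} f"
  shows "Lim (at_right 0) f = (SUP \<epsilon>\<in>{0<..}. f \<epsilon>)"
proof (rule tendsto_Lim)
  show "(f \<longlongrightarrow> (SUP \<epsilon>\<in>{0<..}. f \<epsilon>)) (at_right 0)"
  proof (rule order_tendstoI)
    fix a assume "a < (SUP \<epsilon>\<in>{0<..}. f \<epsilon>)"
    then obtain e where e: "e > 0" "a < f e"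
      by (auto simp: less_SUP_iff)
    have "a < f x" if "0 < x" "x < e" for x
      using e that monotone_onD[OF assms, of x e] by (auto intro: less_le_trans)
    then show "eventually (\<lambda>x. a < f x) (at_right 0)"
      using e by (auto simp: eventually_at_right_field)
  next
    fix a assume *: "(SUP \<epsilon>\<in>{0<..}. f \<epsilon>) < a"
    have "f x < a" if "0 < x" for x
      using that by (intro le_less_trans[OF SUP_upper *]) auto
    then show "eventually (\<lambda>x. f x < a) (at_right 0)"
      by (auto simp: eventually_at_right_field intro: exI[of _ 1])
  qed
qed simp

text \<open>Recursion along a well-order that refines the order by \<open>n\<close>.\<close>

lemma greedy_disjoint_selection:
  fixes n :: "'a \<Rightarrow> nat" and B :: "'a \<Rightarrow> 'b set"
  obtains A where "A \<subseteq> E" "disjoint_family_on B A"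
    "\<And>x. x \<in> E \<Longrightarrow> \<exists>y\<in>A. n y \<le> n x \<and> (x = y \<or> B x \<inter> B y \<noteq> {})"
proof -
  obtain r :: "'a rel" where r: "well_order_on UNIV r"
    using well_order_on by blast
  \<comment> \<open>Ties in \<open>n\<close> are broken by the well-order, so \<open>R\<close> is
    well-founded and total, and earlier points never have larger \<open>n\<close>.\<close>
  define R where "R = inv_image (less_than <*lex*> (r - Id)) (\<lambda>x. (n x, x))"
  have "wf (r - Id)"
    using r by (auto simp: well_order_on_def)
  then have wf: "wf R"
    unfolding R_def by (intro wf_inv_image wf_lex_prod wf_less_than)
  have "(x, y) \<in> r \<or> (y, x) \<in> r" if "x \<noteq> y" for x y
    using r that by (auto simp: well_order_on_def linear_order_on_def total_on_def)
  then have tot: "(x, y) \<in> R \<or> (y, x) \<in> R" if "x \<noteq> y" for x y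
    using that by (cases "n x" "n y" rule: linorder_cases) (auto simp: R_def)
  have R_le: "n y \<le> n x" if "(y, x) \<in> R" for x y
    using that by (auto simp: R_def)
  \<comment> \<open>The greedy rule: a point of \<open>E\<close> is rejected only because of an
    earlier selected one, whose \<open>n\<close> is no larger.\<close>
  define P where "P = wfrec R (\<lambda>p x. x \<in> E \<and> (\<forall>y. (y, x) \<in> R \<longrightarrow> p y \<longrightarrow> B x \<inter> B y = {}))"
  have P: "P x \<longleftrightarrow> x \<in> E \<and> (\<forall>y. (y, x) \<in> R \<longrightarrow> P y \<longrightarrow> B x \<inter> B y = {})" for x
    by (subst def_wfrec[OF eq_reflection[OF P_def] wf]) (auto simp: cut_apply)
  show thesis
  proof (rule that[of "{x. P x}"])
    show "{x. P x} \<subseteq> E"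
      using P by blast
    show "disjoint_family_on B {x. P x}"
      unfolding disjoint_family_on_def using P tot by blast
    show "\<exists>y\<in>{x. P x}. n y \<le> n x \<and> (x = y \<or> B x \<inter> B y \<noteq> {})" if x: "x \<in> E" for x
    proof (cases "P x")
      case False
      then obtain y where "(y, x) \<in> R" "P y" "B x \<inter> B y \<noteq> {}"
        using P[of x] x by blast
      then show ?thesis
        using R_le by blast
    qed blast
  qed
qed

lemma (in finite_measure) sum_measure_disjoint_le:
  assumes "disjoint_family_on B A" "\<And>x. x \<in> A \<Longrightarrow> B x \<in> sets M" "finite F" "F \<subseteq> A"
  shows "(\<Sum>x\<in>F. measure M (B x)) \<le> measure M (space M)"
proof -
  have "(\<Sum>x\<in>F. measure M (B x)) = measure M (\<Union>x\<in>F. B x)"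
    using assms by (intro finite_measure_finite_Union[symmetric])
      (auto intro: disjoint_family_on_mono)
  also have "\<dots> \<le> measure M (space M)"
    by (rule bounded_measure)
  finally show ?thesis .
qed

text \<open>Finite partial sums of the measures are bounded by the total mass, so the family is
  summable, and a summable real family has countable support. This lets a disjoint selection of
  Bowen balls serve as a countable cover.\<close>

lemma (in finite_measure) countable_disjoint_positive_measure:
  assumes "disjoint_family_on B A" "\<And>x. x \<in> A \<Longrightarrow> B x \<in> sets M"
    and pos: "\<And>x. x \<in> A \<Longrightarrow> measure M (B x) > 0"
  shows "countable A"
proof -
  have "(\<lambda>x. measure M (B x)) summable_on A"
    by (rule nonneg_bounded_partial_sums_imp_summable_on[where C = "measure M (space M)"])
      (auto intro!: eventually_finite_subsets_at_top_weakI sum_measure_disjoint_le[OF assms(1,2)])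
  then have "countable {x\<in>A. measure M (B x) \<noteq> 0}"
    by (rule summable_countable_real)
  moreover have "{x\<in>A. measure M (B x) \<noteq> 0} = A"
    using pos by force
  ultimately show ?thesis
    by simp
qed

text \<open>Padding with empty sets outside \<open>I\<close> reduces this to countable
  subadditivity; every finite partial sum is below the unordered sum, which in
  \<open>ennreal\<close> is a supremum.\<close>

lemma emeasure_UN_le_infsum:
  fixes f :: "nat \<Rightarrow> ennreal"
  assumes "\<And>i. i \<in> I \<Longrightarrow> B i \<in> sets M" "\<And>i. i \<in> I \<Longrightarrow> emeasure M (B i) \<le> f i"
  shows "emeasure M (\<Union>i\<in>I. B i) \<le> (\<Sum>\<^sub>\<infinity>i\<in>I. f i)"
proof -
  define C where "C i = (if i \<in> I then B i else {})" for i
  have "(\<Union>i\<in>I. B i) = (\<Union>i. C i)"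
    by (auto simp: C_def split: if_splits)
  also have "emeasure M \<dots> \<le> (\<Sum>i. emeasure M (C i))"
    using assms(1) by (intro emeasure_subadditive_countably) (auto simp: C_def)
  also have "\<dots> \<le> (\<Sum>\<^sub>\<infinity>i\<in>I. f i)"
    unfolding suminf_eq_SUP
  proof (rule SUP_least)
    fix k
    have "(\<Sum>i<k. emeasure M (C i)) = (\<Sum>i\<in>{..<k} \<inter> I. emeasure M (B i))"
      by (auto simp: C_def sum.inter_restrict intro!: sum.cong)
    also have "\<dots> \<le> (\<Sum>i\<in>{..<k} \<inter> I. f i)"
      using assms(2) by (intro sum_mono) auto
    also have "\<dots> \<le> (\<Sum>\<^sub>\<infinity>i\<in>I. f i)"
      by (subst nonneg_infsum_complete) (auto intro!: SUP_upper)
    finally show "(\<Sum>i<k. emeasure M (C i)) \<le> (\<Sum>\<^sub>\<infinity>i\<in>I. f i)" .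
  qed
  finally show ?thesis .
qed

section \<open>Logarithmic rates and the geometry of Bowen balls\<close>

lemma neg_log_antimono: "0 \<le> p \<Longrightarrow> p \<le> q \<Longrightarrow> neg_log q \<le> neg_log p"
  by (auto simp: neg_log_def)

text \<open>Translates between entropy quotients and exponential bounds on measures. For
  \<open>p = 0\<close> both sides are false, the quotient being infinite.\<close>

lemma neg_log_div_less_iff:
  assumes "0 \<le> p" "0 < n"
  shows "neg_log p / ereal (real n) < ereal t \<longleftrightarrow> exp (- real n * t) < p"
proof (cases "p = 0")
  case False
  then have "exp (- real n * t) < p \<longleftrightarrow> - real n * t < ln p"
    using assms by (metis exp_less_cancel_iff exp_ln order_less_le)
  then show ?thesis
    using assms False by (auto simp: neg_log_def field_simps)
qed (use assms in \<open>auto simp: neg_log_def\<close>)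

lemma nds_iter_continuous:
  assumes "nds X T"
  shows "continuous_map (mtopology_of (X 0)) (mtopology_of (X j)) (nds_iter T j)"
proof (induction j)
  case (Suc j)
  then show ?case
    using assms by (auto simp: nds_def simp del: o_apply intro: continuous_map_compose)
qed (simp add: id_def)

lemma nds_iter_in_mspace:
  assumes "nds X T" "x \<in> mspace (X 0)"
  shows "nds_iter T j x \<in> mspace (X j)"
  using continuous_map_image_subset_topspace[OF nds_iter_continuous[OF assms(1), of j]] assms(2)
  by (auto simp: image_subset_iff)

text \<open>A finite maximum is below a bound iff all its entries are. By truncated subtraction,
  \<open>n = 0\<close> gives the same ball as \<open>n = 1\<close>.\<close>

lemma in_bowen_ball_iff:
  "y \<in> bowen_ball X T n x \<epsilon> \<longleftrightarrow> y \<in> mspace (X 0) \<and>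
     (\<forall>j\<le>n - 1. mdist (X j) (nds_iter T j x) (nds_iter T j y) < \<epsilon>)"
  by (auto simp: bowen_ball_def bowen_dist_def Max_less_iff)

lemma bowen_ball_mono: "\<epsilon> \<le> \<delta> \<Longrightarrow> bowen_ball X T n x \<epsilon> \<subseteq> bowen_ball X T n x \<delta>"
  by (force simp: in_bowen_ball_iff)

lemma centre_in_bowen_ball:
  assumes "nds X T" "x \<in> mspace (X 0)" "\<epsilon> > 0"
  shows "x \<in> bowen_ball X T n x \<epsilon>"
proof -
  have "mdist (X j) (nds_iter T j x) (nds_iter T j x) = 0" for j
    using nds_iter_in_mspace[OF assms(1,2)] by simp
  then show ?thesis
    using assms by (simp add: in_bowen_ball_iff)
qed

lemma bowen_ball_sym:
  "x \<in> mspace (X 0) \<Longrightarrow> y \<in> bowen_ball X T n x \<epsilon> \<Longrightarrow> x \<in> bowen_ball X T n y \<epsilon>"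
  by (auto simp: in_bowen_ball_iff mdist_commute)

lemma bowen_ball_antimono_time: "m \<le> n \<Longrightarrow> bowen_ball X T n x \<epsilon> \<subseteq> bowen_ball X T m x \<epsilon>"
  by (force simp: in_bowen_ball_iff)

lemma bowen_ball_triangle:
  assumes "nds X T" "x \<in> mspace (X 0)" "y \<in> bowen_ball X T n x \<epsilon>" "z \<in> bowen_ball X T n y \<delta>"
  shows "z \<in> bowen_ball X T n x (\<epsilon> + \<delta>)"
  unfolding in_bowen_ball_iff
proof safe
  show "z \<in> mspace (X 0)"
    using assms by (auto simp: in_bowen_ball_iff)
  fix j assume "j \<le> n - 1"
  then show "mdist (X j) (nds_iter T j x) (nds_iter T j z) < \<epsilon> + \<delta>"
    using assms mdist_triangle[of "nds_iter T j x" "X j" "nds_iter T j y" "nds_iter T j z"]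
      nds_iter_in_mspace[OF assms(1), of _ j] by (force simp: in_bowen_ball_iff)
qed

text \<open>Finitely many continuous iterates pull open balls back to open sets, so Bowen balls are
  open.\<close>

lemma bowen_ball_sets:
  assumes "nds X T" "x \<in> mspace (X 0)"
  shows "bowen_ball X T n x \<epsilon> \<in> sets (borel_of_metric (X 0))"
proof -
  have eq: "bowen_ball X T n x \<epsilon> = (\<Inter>j\<in>{..n - 1}.
      {y \<in> topspace (mtopology_of (X 0)). nds_iter T j y \<in> mball_of (X j) (nds_iter T j x) \<epsilon>})"
    using nds_iter_in_mspace[OF assms(1)] assms(2) by (auto simp: in_bowen_ball_iff)
  have "openin (mtopology_of (X j)) (mball_of (X j) c \<epsilon>)" for j c
    by (simp add: mtopology_of_def mball_of_def Metric_space.openin_mball)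
  then have "openin (mtopology_of (X 0)) (bowen_ball X T n x \<epsilon>)"
    unfolding eq
    by (intro openin_INT2 openin_continuous_map_preimage[OF nds_iter_continuous[OF assms(1)]]) auto
  then show ?thesis
    unfolding borel_of_metric_def
    by (intro in_measure_of) (use openin_subset[of "mtopology_of (X 0)"] in auto)
qed

section \<open>Monotone limits in the entropies as suprema\<close>

lemma bowen_sum_eq_SUP: "bowen_sum X T s \<epsilon> Z = (SUP N. bowen_sum_N X T s N \<epsilon> Z)"
proof -
  have "incseq (\<lambda>N. bowen_sum_N X T s N \<epsilon> Z)"
    unfolding bowen_sum_N_def
    by (intro monoI Inf_superset_mono) (fastforce simp: bowen_cover_def)
  then show ?thesis
    unfolding bowen_sum_def by (intro limI LIMSEQ_SUP)
qed

text \<open>A cover at radius \<open>\<epsilon>\<close> remains one at radius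
  \<open>\<delta>\<close> with the same times and weights, so the infimum at \<open>\<delta>\<close>
  runs over more covers.\<close>

lemma bowen_sum_antimono:
  assumes "\<epsilon> \<le> \<delta>"
  shows "bowen_sum X T s \<delta> Z \<le> bowen_sum X T s \<epsilon> Z"
proof -
  have "bowen_cover X T N \<delta> Z I n x" if "bowen_cover X T N \<epsilon> Z I n x" for N I n x
    using that bowen_ball_mono[OF assms, of X T] unfolding bowen_cover_def
    by (meson UN_mono order_refl order_trans)
  then show ?thesis
    unfolding bowen_sum_eq_SUP bowen_sum_N_def
    by (intro SUP_mono' Inf_superset_mono) blast
qed

lemma bowen_entropy_eq_SUP:
  "bowen_entropy X T Z = (SUP \<epsilon>\<in>{0<..}. Inf {ereal s |s. bowen_sum X T s \<epsilon> Z = 0})"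
  unfolding bowen_entropy_def
proof (intro Lim_at_right_0_antimono monotone_onI Inf_superset_mono)
  fix \<epsilon> \<delta> :: real
  assume "\<epsilon> \<le> \<delta>"
  then have "bowen_sum X T s \<epsilon> Z = 0 \<Longrightarrow> bowen_sum X T s \<delta> Z = 0" for s
    using bowen_sum_antimono[of \<epsilon> \<delta> X T s Z] by simp
  then show "{ereal s |s. bowen_sum X T s \<epsilon> Z = 0} \<subseteq> {ereal s |s. bowen_sum X T s \<delta> Z = 0}"
    by blast
qed

lemma lower_local_entropy_eq_SUP:
  assumes "nds X T" "finite_measure \<mu>" "sets \<mu> = sets (borel_of_metric (X 0))"
    and "x \<in> mspace (X 0)"
  shows "lower_local_entropy X T \<mu> x = (SUP \<epsilon>\<in>{0<..}.
    liminf (\<lambda>n. neg_log (measure \<mu> (bowen_ball X T n x \<epsilon>)) / ereal (real n)))"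
  unfolding lower_local_entropy_def
\<comment> \<open>The quotient by \<open>n = 0\<close> is discarded: a lower limit needs only
  eventual comparison.\<close>
proof (intro Lim_at_right_0_antimono monotone_onI Liminf_mono eventually_mono[OF eventually_gt_at_top[of 0]])
  interpret finite_measure \<mu> by fact
  fix \<epsilon> \<delta> :: real and n :: nat
  assume "\<epsilon> \<le> \<delta>" "0 < n"
  have "measure \<mu> (bowen_ball X T n x \<epsilon>) \<le> measure \<mu> (bowen_ball X T n x \<delta>)"
    using assms \<open>\<epsilon> \<le> \<delta>\<close> by (intro finite_measure_mono bowen_ball_mono) (auto intro: bowen_ball_sets)
  then show "neg_log (measure \<mu> (bowen_ball X T n x \<delta>)) / ereal (real n)
      \<le> neg_log (measure \<mu> (bowen_ball X T n x \<epsilon>)) / ereal (real n)"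
    using \<open>0 < n\<close> by (intro ereal_divide_right_mono neg_log_antimono) auto
qed

section \<open>Upper bound by a Vitali-type covering\<close>

text \<open>Selecting in order of increasing \<open>n\<close> matters: an unselected ball meets a
  selected one of no larger time, and up to that time both have radius \<open>\<epsilon>\<close>, so
  doubling the radius of the selected ball captures the other centre.\<close>

lemma bowen_cover_from_large_balls:
  assumes nds: "nds X T" and "prob_space \<mu>" and sets: "sets \<mu> = sets (borel_of_metric (X 0))"
    and E: "E \<subseteq> mspace (X 0)" and "\<epsilon> > 0"
    and large: "\<And>x. x \<in> E \<Longrightarrow>
      N \<le> n x \<and> exp (- real (n x) * t) < measure \<mu> (bowen_ball X T (n x) x \<epsilon>)"
  shows "\<exists>I m c. bowen_cover X T N (2 * \<epsilon>) E I m c \<and>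
    (\<Sum>\<^sub>\<infinity>i\<in>I. ennreal (exp (- real (m i) * t))) \<le> 1"
proof -
  interpret prob_space \<mu> by fact
  define B where "B x = bowen_ball X T (n x) x \<epsilon>" for x
  obtain A where A: "A \<subseteq> E" and disj: "disjoint_family_on B A"
    and sel: "\<And>x. x \<in> E \<Longrightarrow> \<exists>y\<in>A. n y \<le> n x \<and> (x = y \<or> B x \<inter> B y \<noteq> {})"
    using greedy_disjoint_selection[of E B n] by metis
  have B_sets: "B x \<in> sets \<mu>" if "x \<in> A" for x
    using that A E nds sets by (auto simp: B_def intro: bowen_ball_sets)
  have lt: "exp (- real (n x) * t) < measure \<mu> (B x)" if "x \<in> A" for x
    using that A large by (auto simp: B_def)
  have "countable A"
    using disj B_sets
    by (rule countable_disjoint_positive_measure) (auto intro: less_trans[OF exp_gt_zero lt])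
  \<comment> \<open>Enumerating the countable set \<open>A\<close> supplies the natural-number
    indices that \<open>bowen_cover\<close> demands.\<close>
  define I c where "I = to_nat_on A ` A" and "c = from_nat_into A"
  have bij: "bij_betw c I A"
    unfolding I_def c_def using \<open>countable A\<close>
    by (intro bij_betwI[of _ _ _ "to_nat_on A"]) (auto simp: from_nat_into_to_nat_on)
  have "E \<subseteq> (\<Union>y\<in>A. bowen_ball X T (n y) y (2 * \<epsilon>))"
  proof
    fix x assume "x \<in> E"
    then obtain y where y: "y \<in> A" "n y \<le> n x" "x = y \<or> B x \<inter> B y \<noteq> {}"
      using sel by blast
    have sp: "x \<in> mspace (X 0)" "y \<in> mspace (X 0)"
      using \<open>x \<in> E\<close> y A E by auto
    have "x \<in> bowen_ball X T (n y) y (2 * \<epsilon>)"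
    proof (cases "x = y")
      case True
      then show ?thesis
        using centre_in_bowen_ball[OF nds sp(1)] \<open>\<epsilon> > 0\<close> by simp
    next
      case False
      then obtain z where z: "z \<in> B x" "z \<in> B y"
        using y by blast
      \<comment> \<open>Shortening the time from \<open>n x\<close> to \<open>n y\<close> only
        enlarges the ball at \<open>x\<close>, so both balls can be compared at time
        \<open>n y\<close>.\<close>
      have "z \<in> bowen_ball X T (n y) x \<epsilon>"
        using z subsetD[OF bowen_ball_antimono_time[OF y(2)]] by (simp add: B_def)
      then have "x \<in> bowen_ball X T (n y) z \<epsilon>"
        using bowen_ball_sym[of x X z T "n y" \<epsilon>] sp by blast
      then show ?thesis
        using bowen_ball_triangle[OF nds sp(2), of z "n y" \<epsilon> x \<epsilon>] z by (simp add: B_def)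
    qed
    then show "x \<in> (\<Union>y\<in>A. bowen_ball X T (n y) y (2 * \<epsilon>))"
      using y by blast
  qed
  then have "bowen_cover X T N (2 * \<epsilon>) E I (n \<circ> c) c"
    using bij_betw_imp_surj_on[OF bij] A E large unfolding bowen_cover_def by fastforce
  moreover have "(\<Sum>\<^sub>\<infinity>i\<in>I. ennreal (exp (- real ((n \<circ> c) i) * t))) \<le> 1"
  proof -
    have "(\<Sum>\<^sub>\<infinity>i\<in>I. ennreal (exp (- real ((n \<circ> c) i) * t)))
        = (\<Sum>\<^sub>\<infinity>x\<in>A. ennreal (exp (- real (n x) * t)))"
      using infsum_reindex_bij_betw[OF bij, of "\<lambda>x. ennreal (exp (- real (n x) * t))"] by simp
    also have "\<dots> \<le> 1"
    proof (subst nonneg_infsum_complete, simp, rule SUP_least)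
      fix F assume "F \<in> {F. finite F \<and> F \<subseteq> A}"
      then have F: "finite F" "F \<subseteq> A" by auto
      \<comment> \<open>The weights are dominated by measures of disjoint sets, whose total is at
        most 1.\<close>
      have "(\<Sum>x\<in>F. exp (- real (n x) * t)) \<le> (\<Sum>x\<in>F. measure \<mu> (B x))"
        using F lt by (intro sum_mono less_imp_le) blast
      also have "\<dots> \<le> 1"
        using sum_measure_disjoint_le[OF disj B_sets F] by (simp add: prob_space)
      finally show "(\<Sum>x\<in>F. ennreal (exp (- real (n x) * t))) \<le> 1"
        by (simp add: sum_ennreal)
    qed
    finally show ?thesis .
  qed
  ultimately show ?thesis
    by blast
qed

text \<open>Raising the exponent from \<open>t\<close> to \<open>u\<close> multiplies the weight of
  index \<open>i\<close> by \<open>exp (- real (m i) * (u - t))\<close>, and \<open>m i\<close> is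
  at least \<open>N\<close>. A bounded total at \<open>t\<close> thus becomes exponentially small in
  \<open>N\<close> when \<open>t < u\<close>.\<close>

lemma bowen_sum_N_le_exp:
  assumes "bowen_cover X T N \<epsilon> Z I m c" "(\<Sum>\<^sub>\<infinity>i\<in>I. ennreal (exp (- real (m i) * t))) \<le> 1"
    and "t \<le> u"
  shows "bowen_sum_N X T u N \<epsilon> Z \<le> ennreal (exp (- real N * (u - t)))"
proof -
  let ?e = "ennreal (exp (- real N * (u - t)))"
  have "bowen_sum_N X T u N \<epsilon> Z \<le> (\<Sum>\<^sub>\<infinity>i\<in>I. ennreal (exp (- real (m i) * u)))"
    unfolding bowen_sum_N_def using assms(1) by (intro Inf_lower) blast
  also have "\<dots> \<le> ?e"
  proof (subst nonneg_infsum_complete, simp, rule SUP_least)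
    fix F assume "F \<in> {F. finite F \<and> F \<subseteq> I}"
    then have F: "finite F" "F \<subseteq> I" by auto
    have "exp (- real (m i) * u) \<le> exp (- real N * (u - t)) * exp (- real (m i) * t)"
      if "i \<in> I" for i
    proof -
      have "real N * (u - t) \<le> real (m i) * (u - t)"
        using assms(1,3) that by (intro mult_right_mono) (auto simp: bowen_cover_def)
      then show ?thesis
        by (simp add: mult_exp_exp algebra_simps)
    qed
    then have "(\<Sum>i\<in>F. ennreal (exp (- real (m i) * u)))
        \<le> (\<Sum>i\<in>F. ?e * ennreal (exp (- real (m i) * t)))"
      using F by (intro sum_mono) (auto simp: ennreal_mult[symmetric])
    also have "\<dots> = ?e * (\<Sum>i\<in>F. ennreal (exp (- real (m i) * t)))"
      by (rule sum_distrib_left[symmetric])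
    also have "\<dots> \<le> ?e * 1"
    proof (rule mult_left_mono)
      have "(\<Sum>i\<in>F. ennreal (exp (- real (m i) * t)))
          \<le> (\<Sum>\<^sub>\<infinity>i\<in>I. ennreal (exp (- real (m i) * t)))"
        using F by (subst nonneg_infsum_complete) (auto intro!: SUP_upper)
      then show "(\<Sum>i\<in>F. ennreal (exp (- real (m i) * t))) \<le> 1"
        using assms(2) by (rule order_trans)
    qed simp
    finally show "(\<Sum>i\<in>F. ennreal (exp (- real (m i) * u))) \<le> ?e"
      by simp
  qed
  finally show ?thesis .
qed

lemma bowen_entropy_le:
  assumes nds: "nds X T" and "prob_space \<mu>" and sets: "sets \<mu> = sets (borel_of_metric (X 0))"
    and E: "E \<subseteq> mspace (X 0)" and le: "\<And>x. x \<in> E \<Longrightarrow> lower_local_entropy X T \<mu> x \<le> ereal s"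
  shows "bowen_entropy X T E \<le> ereal s"
  unfolding bowen_entropy_eq_SUP
proof (rule SUP_least, rule ereal_le_epsilon2)
  interpret prob_space \<mu> by fact
  fix \<epsilon> e :: real
  assume "\<epsilon> \<in> {0<..}" "0 < e"
  \<comment> \<open>Half the radius is used because the covering lemma doubles it.\<close>
  then have "\<epsilon> / 2 > 0" by simp
  \<comment> \<open>Two strict gaps: \<open>s < t\<close> produces large balls, and
    \<open>t < s + e\<close> makes the sums decay in \<open>N\<close>.\<close>
  define t where "t = s + e / 2"
  have "s < t" "t < s + e"
    using \<open>0 < e\<close> by (auto simp: t_def)
  have bound: "bowen_sum_N X T (s + e) N \<epsilon> E \<le> ennreal (exp (- real N * (s + e - t)))" for N
  proof -
    have "\<exists>n\<ge>N. exp (- real n * t) < measure \<mu> (bowen_ball X T n x (\<epsilon> / 2))" if "x \<in> E" for x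
    proof (rule ccontr)
      assume neg: "\<not> ?thesis"
      \<comment> \<open>Failure from \<open>N\<close> on keeps the quotients at least
        \<open>t\<close>, so the local entropy at \<open>x\<close> would exceed \<open>s\<close>.
        Starting at \<open>max N 1\<close> avoids \<open>n = 0\<close>.\<close>
      have "ereal t \<le> liminf (\<lambda>n. neg_log (measure \<mu> (bowen_ball X T n x (\<epsilon> / 2))) / ereal (real n))"
      proof (rule Liminf_bounded, rule eventually_sequentiallyI)
        fix n assume "max N 1 \<le> n"
        then have "0 < n" "\<not> exp (- real n * t) < measure \<mu> (bowen_ball X T n x (\<epsilon> / 2))"
          using neg by auto
        then show "ereal t \<le> neg_log (measure \<mu> (bowen_ball X T n x (\<epsilon> / 2))) / ereal (real n)"
          by (simp only: neg_log_div_less_iff[symmetric] measure_nonneg not_less)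
      qed
      also have "\<dots> \<le> lower_local_entropy X T \<mu> x"
        using that E \<open>\<epsilon> / 2 > 0\<close>
        by (subst lower_local_entropy_eq_SUP[OF nds finite_measure_axioms sets]) (auto intro!: SUP_upper)
      also have "\<dots> \<le> ereal s"
        by (rule le[OF that])
      finally show False
        using \<open>s < t\<close> by simp
    qed
    then obtain n where "\<And>x. x \<in> E \<Longrightarrow>
        N \<le> n x \<and> exp (- real (n x) * t) < measure \<mu> (bowen_ball X T (n x) x (\<epsilon> / 2))"
      by metis
    from bowen_cover_from_large_balls[OF nds \<open>prob_space \<mu>\<close> sets E \<open>\<epsilon> / 2 > 0\<close> this]
    obtain I m c where "bowen_cover X T N \<epsilon> E I m c"
      "(\<Sum>\<^sub>\<infinity>i\<in>I. ennreal (exp (- real (m i) * t))) \<le> 1"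
      by auto
    then show ?thesis
      using \<open>t < s + e\<close> by (intro bowen_sum_N_le_exp) auto
  qed
  \<comment> \<open>The values increase with \<open>N\<close>, so each is below all later bounds,
    and these tend to 0.\<close>
  have "bowen_sum_N X T (s + e) N \<epsilon> E \<le> 0" for N
  proof (rule tendsto_lowerbound)
    have "(\<lambda>k. exp (- real k * (s + e - t))) \<longlonglongrightarrow> 0"
      using \<open>t < s + e\<close> by real_asymp
    then show "(\<lambda>k. ennreal (exp (- real k * (s + e - t)))) \<longlonglongrightarrow> 0"
      using tendsto_ennrealI by fastforce
    have "bowen_sum_N X T (s + e) N \<epsilon> E \<le> bowen_sum_N X T (s + e) k \<epsilon> E" if "N \<le> k" for k
      unfolding bowen_sum_N_def using that
      by (intro Inf_superset_mono) (fastforce simp: bowen_cover_def)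
    then show "\<forall>\<^sub>F k in sequentially.
        bowen_sum_N X T (s + e) N \<epsilon> E \<le> ennreal (exp (- real k * (s + e - t)))"
      using bound by (auto simp: eventually_sequentially intro: order_trans)
  qed simp
  then have "bowen_sum X T (s + e) \<epsilon> E = 0"
    by (simp add: bowen_sum_eq_SUP)
  then show "Inf {ereal s |s. bowen_sum X T s \<epsilon> E = 0} \<le> ereal s + ereal e"
    by (intro Inf_lower) auto
qed

section \<open>Lower bound by mass distribution\<close>

text \<open>Each cover member meeting \<open>Y\<close> has measure at most its weight, so covers of
  arbitrarily small total weight enclose \<open>Y\<close> in sets of arbitrarily small measure.
  \<open>Y\<close> is not assumed measurable, hence the null superset.\<close>

lemma null_set_of_bowen_sum_eq_0:
  assumes nds: "nds X T" and "prob_space \<mu>" and sets: "sets \<mu> = sets (borel_of_metric (X 0))"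
    and Y: "Y \<subseteq> Z" "Y \<subseteq> mspace (X 0)"
    and small: "\<And>x n. x \<in> Y \<Longrightarrow> k \<le> n \<Longrightarrow>
      measure \<mu> (bowen_ball X T n x \<epsilon>) \<le> exp (- real n * t)"
    and zero: "bowen_sum X T u (\<epsilon> / 2) Z = 0" and "u \<le> t"
  shows "\<exists>U \<in> null_sets \<mu>. Y \<subseteq> U"
proof -
  interpret prob_space \<mu> by fact
  have approx: "\<exists>U \<in> sets \<mu>. Y \<subseteq> U \<and> emeasure \<mu> U \<le> ennreal (1 / Suc j)" for j
  proof -
    \<comment> \<open>A vanishing supremum gives 0 at \<open>N = k\<close> in particular; covers
      then use only times at least \<open>k\<close>, where \<open>small\<close> applies.\<close>
    have "bowen_sum_N X T u k (\<epsilon> / 2) Z = 0"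
      using zero by (simp add: bowen_sum_eq_SUP bot_ennreal[symmetric] del: bot_ennreal)
    then have "bowen_sum_N X T u k (\<epsilon> / 2) Z < ennreal (1 / Suc j)"
      by (simp add: ennreal_zero_less_divide)
    then obtain I n x where cov: "bowen_cover X T k (\<epsilon> / 2) Z I n x"
      and sum: "(\<Sum>\<^sub>\<infinity>i\<in>I. ennreal (exp (- real (n i) * u))) < ennreal (1 / Suc j)"
      unfolding bowen_sum_N_def Inf_less_iff by blast
    define C where "C i = bowen_ball X T (n i) (x i) (\<epsilon> / 2)" for i
    \<comment> \<open>Only members meeting \<open>Y\<close> can be compared with a ball centred in
      \<open>Y\<close>; the rest are dropped.\<close>
    define J where "J = {i\<in>I. C i \<inter> Y \<noteq> {}}"
    have xi: "x i \<in> mspace (X 0)" "k \<le> n i" if "i \<in> I" for i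
      using cov that by (auto simp: bowen_cover_def)
    have C_sets: "C i \<in> sets \<mu>" if "i \<in> I" for i
      using xi[OF that] nds sets by (auto simp: C_def intro: bowen_ball_sets)
    have C_le: "emeasure \<mu> (C i) \<le> ennreal (exp (- real (n i) * u))" if i: "i \<in> J" for i
    proof -
      obtain y where y: "y \<in> C i" "y \<in> Y" and "i \<in> I"
        using i by (auto simp: J_def)
      \<comment> \<open>Recentring at a point of \<open>Y\<close> doubles the radius, which is why
        \<open>zero\<close> is stated at \<open>\<epsilon> / 2\<close>.\<close>
      have "C i \<subseteq> bowen_ball X T (n i) y \<epsilon>"
      proof
        fix z assume "z \<in> C i"
        moreover have "x i \<in> bowen_ball X T (n i) y (\<epsilon> / 2)"
          using y xi[OF \<open>i \<in> I\<close>] by (auto simp: C_def intro: bowen_ball_sym)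
        moreover have "y \<in> mspace (X 0)"
          using y Y by blast
        ultimately show "z \<in> bowen_ball X T (n i) y \<epsilon>"
          using bowen_ball_triangle[OF nds, of y "x i" "n i" "\<epsilon> / 2" z "\<epsilon> / 2"] by (simp add: C_def)
      qed
      then have "measure \<mu> (C i) \<le> measure \<mu> (bowen_ball X T (n i) y \<epsilon>)"
        using y Y nds sets by (intro finite_measure_mono) (auto intro: bowen_ball_sets)
      also have "\<dots> \<le> exp (- real (n i) * t)"
        using small y xi[OF \<open>i \<in> I\<close>] by blast
      also have "\<dots> \<le> exp (- real (n i) * u)"
        using \<open>u \<le> t\<close> by (simp add: mult_left_mono)
      finally show ?thesis
        by (simp add: emeasure_eq_measure)
    qed
    have "emeasure \<mu> (\<Union>i\<in>J. C i) \<le> (\<Sum>\<^sub>\<infinity>i\<in>J. ennreal (exp (- real (n i) * u)))"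
      using C_sets C_le by (intro emeasure_UN_le_infsum) (auto simp: J_def)
    also have "\<dots> \<le> (\<Sum>\<^sub>\<infinity>i\<in>I. ennreal (exp (- real (n i) * u)))"
      by (rule infsum_mono_neutral) (auto simp: J_def intro!: nonneg_summable_on_complete)
    finally have "emeasure \<mu> (\<Union>i\<in>J. C i) \<le> ennreal (1 / Suc j)"
      using sum by simp
    moreover have "Y \<subseteq> (\<Union>i\<in>J. C i)"
      using cov Y by (fastforce simp: bowen_cover_def J_def C_def)
    moreover have "(\<Union>i\<in>J. C i) \<in> sets \<mu>"
      using C_sets by (intro sets.countable_UN') (auto simp: J_def)
    ultimately show ?thesis
      by blast
  qed
  then obtain U where U: "\<And>j. U j \<in> sets \<mu>" "\<And>j. Y \<subseteq> U j"
    "\<And>j. emeasure \<mu> (U j) \<le> ennreal (1 / Suc j)"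
    by metis
  have "emeasure \<mu> (\<Inter>j. U j) \<le> 0"
  proof (rule tendsto_lowerbound)
    have "(\<lambda>j. 1 / real (Suc j)) \<longlonglongrightarrow> 0"
      by real_asymp
    then show "(\<lambda>j. ennreal (1 / Suc j)) \<longlonglongrightarrow> 0"
      using tendsto_ennrealI by fastforce
    have "emeasure \<mu> (\<Inter>j. U j) \<le> ennreal (1 / Suc j)" for j
      by (rule order_trans[OF emeasure_mono U(3)]) (use U(1) in auto)
    then show "\<forall>\<^sub>F j in sequentially. emeasure \<mu> (\<Inter>j. U j) \<le> ennreal (1 / Suc j)"
      by simp
  qed simp
  then have "(\<Inter>j. U j) \<in> null_sets \<mu>"
    using U(1) by (intro null_setsI) auto
  then show ?thesis
    using U(2) by blast
qed

lemma bowen_entropy_ge: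
  assumes nds: "nds X T" and "prob_space \<mu>" and sets: "sets \<mu> = sets (borel_of_metric (X 0))"
    and E: "E \<subseteq> mspace (X 0)" and ge: "\<And>x. x \<in> E \<Longrightarrow> ereal s \<le> lower_local_entropy X T \<mu> x"
    and pos: "measure \<mu> E > 0"
  shows "ereal s \<le> bowen_entropy X T E"
proof (rule ccontr)
  interpret prob_space \<mu> by fact
  assume "\<not> ereal s \<le> bowen_entropy X T E"
  then obtain t where t: "bowen_entropy X T E < ereal t" "ereal t < ereal s"
    using ereal_dense2[of "bowen_entropy X T E" "ereal s"] by (auto simp: not_le)
  \<comment> \<open>One index serves both as starting time and for the radius, since both conditions
    weaken as \<open>k\<close> grows.\<close>
  define Y where "Y k = {x\<in>E. \<forall>n\<ge>k.
    measure \<mu> (bowen_ball X T n x (1 / Suc k)) \<le> exp (- real n * t)}" for k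
  have "\<exists>U \<in> null_sets \<mu>. Y k \<subseteq> U" for k
  proof -
    \<comment> \<open>The radius is half of that in \<open>Y k\<close>, as the null set lemma
      requires.\<close>
    have "Inf {ereal u |u. bowen_sum X T u (1 / Suc k / 2) E = 0} \<le> bowen_entropy X T E"
      unfolding bowen_entropy_eq_SUP by (rule SUP_upper) simp
    then have "Inf {ereal u |u. bowen_sum X T u (1 / Suc k / 2) E = 0} < ereal t"
      using t(1) by (rule le_less_trans)
    then obtain u where "bowen_sum X T u (1 / Suc k / 2) E = 0" "u < t"
      by (auto simp: Inf_less_iff)
    then show ?thesis
      using E by (intro null_set_of_bowen_sum_eq_0[OF nds \<open>prob_space \<mu>\<close> sets,
            where Z = E and k = k and \<epsilon> = "1 / Suc k" and t = t and u = u]) (auto simp: Y_def)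
  qed
  then obtain U where U: "\<And>k. U k \<in> null_sets \<mu>" "\<And>k. Y k \<subseteq> U k"
    by metis
  have "E \<subseteq> (\<Union>k. Y k)"
  proof
    fix x assume "x \<in> E"
    let ?f = "\<lambda>\<epsilon> n. neg_log (measure \<mu> (bowen_ball X T n x \<epsilon>)) / ereal (real n)"
    have "x \<in> mspace (X 0)"
      using \<open>x \<in> E\<close> E by blast
    have "ereal t < (SUP \<epsilon>\<in>{0<..}. liminf (?f \<epsilon>))"
      using less_le_trans[OF t(2) ge[OF \<open>x \<in> E\<close>]]
        lower_local_entropy_eq_SUP[OF nds finite_measure_axioms sets \<open>x \<in> mspace (X 0)\<close>] by simp
    then obtain \<epsilon> where \<epsilon>: "\<epsilon> > 0" "ereal t < liminf (?f \<epsilon>)"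
      by (auto simp: less_SUP_iff)
    then have "eventually (\<lambda>n. ereal t < ?f \<epsilon> n) sequentially"
      by (intro less_LiminfD)
    then obtain N where N: "\<And>n. n \<ge> N \<Longrightarrow> ereal t < ?f \<epsilon> n"
      by (auto simp: eventually_sequentially)
    obtain K where K: "1 / Suc K < \<epsilon>"
      using \<epsilon>(1) nat_approx_posE by blast
    \<comment> \<open>\<open>N\<close> secures the bound in time, \<open>K\<close> the radius, and 1
      keeps \<open>n\<close> positive for \<open>neg_log_div_less_iff\<close>.\<close>
    define k where "k = max (max N K) 1"
    have "1 / Suc k \<le> 1 / Suc K"
      by (simp add: k_def frac_le)
    then have "1 / Suc k \<le> \<epsilon>"
      using K by linarith
    have "measure \<mu> (bowen_ball X T n x (1 / Suc k)) \<le> exp (- real n * t)" if "k \<le> n" for n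
    proof -
      have "measure \<mu> (bowen_ball X T n x (1 / Suc k)) \<le> measure \<mu> (bowen_ball X T n x \<epsilon>)"
        using \<open>1 / Suc k \<le> \<epsilon>\<close> \<open>x \<in> mspace (X 0)\<close> nds sets
        by (intro finite_measure_mono bowen_ball_mono) (auto intro: bowen_ball_sets)
      also have "\<dots> \<le> exp (- real n * t)"
        using N[of n] that neg_log_div_less_iff[of "measure \<mu> (bowen_ball X T n x \<epsilon>)" n t]
        by (force simp: k_def not_less[symmetric])
      finally show ?thesis .
    qed
    then show "x \<in> (\<Union>k. Y k)"
      using \<open>x \<in> E\<close> by (auto simp: Y_def)
  qed
  then have "E \<subseteq> (\<Union>k. U k)"
    using U(2) by blast
  moreover have "(\<Union>k. U k) \<in> null_sets \<mu>"
    using U(1) by blast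
  ultimately have "measure \<mu> E \<le> 0"
    using finite_measure_mono[of E "\<Union>k. U k"] by (auto simp: measure_eq_0_null_sets)
  then show False
    using pos by simp
qed

theorem corollary2p5:
  fixes X :: "nat \<Rightarrow> 'a metric"
    and T :: "nat \<Rightarrow> 'a \<Rightarrow> 'a"
    and E :: "'a set"
    and s :: real
    and \<mu> :: "'a measure"
  assumes "nds X T"
    and "E \<in> sets (borel_of_metric (X 0))"
    and "s > 0"
    and "prob_space \<mu>"
    and "sets \<mu> = sets (borel_of_metric (X 0))"
  shows "((\<forall>x\<in>E. lower_local_entropy X T \<mu> x \<le> ereal s) \<longrightarrow> bowen_entropy X T E \<le> ereal s) \<and>
         ((\<forall>x\<in>E. lower_local_entropy X T \<mu> x \<ge> ereal s) \<and> measure \<mu> E > 0 \<longrightarrow>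
           bowen_entropy X T E \<ge> ereal s)"
proof -
  have "space (borel_of_metric (X 0)) = mspace (X 0)"
    unfolding borel_of_metric_def
    by (intro space_measure_of) (use openin_subset[of "mtopology_of (X 0)"] in auto)
  then have "E \<subseteq> mspace (X 0)"
    using sets.sets_into_space[OF assms(2)] by simp
  then show ?thesis
    using bowen_entropy_le[OF assms(1,4,5)] bowen_entropy_ge[OF assms(1,4,5)] by blast
qed

end
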